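(* Let $m$ be an integer with $m\equiv 1 \pmod 6$ and $m\ge 7$. Then there exists a $(3,m-2,m)$ Latin trade.
   Context: A partial Latin square is a square array, some of whose cells are filled with symbols from a finite set and the others empty, such that each symbol occurs at most once in each row and at most once in each column. For a positive integer $\mu$, a $\mu$-way Latin trade is a tuple $(T_1,\dots,T_\mu)$ of partial Latin squares with exactly the same set of filled cells such that: every filled cell $(i,j)$ contains pairwise different entries in $T_1,\dots,T_\mu$; for each row $i$, the set of symbols in row $i$ is the same in all of $T_1,\dots,T_\mu$; and for each column $j$, the set of symbols in column $j$ is the same in all of $T_1,\dots,T_\mu$. For $\mu\le k\le m$, a $(\mu,k,m)$ Latin trade (also called a $\mu$-way $k$-homogeneous Latin trade) is a $\mu$-way Latin trade $(T_1,\dots,T_\mu)$ consisting of $m\times m$ arrays on a set of $m$ symbols such that in each $T_r$ every row has exactly $k$ filled cells, every column has exactly $k$ filled cells, and every symbol appears exactly $k$ times. *)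

theory Defs
  imports Main
begin

text \<open>
  An \<open>n \<times> n\<close> array with possibly empty cells is a function \<open>L\<close>: rows and columns are
  numbered \<open>0, \<dots>, n - 1\<close>, and \<open>L i j\<close> is \<open>Some x\<close> if cell \<open>(i, j)\<close> contains \<open>x\<close> and \<open>None\<close>
  if it is empty. Positions outside the array are required to be \<open>None\<close>.
\<close>

type_synonym 's parray = "nat \<Rightarrow> nat \<Rightarrow> 's option"

definition filled_cells :: "'s parray \<Rightarrow> (nat \<times> nat) set" where
  "filled_cells L = {(i, j). L i j \<noteq> None}"

definition row_symbols :: "'s parray \<Rightarrow> nat \<Rightarrow> 's set" where
  "row_symbols L i = {x. \<exists>j. L i j = Some x}"

definition col_symbols :: "'s parray \<Rightarrow> nat \<Rightarrow> 's set" where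
  "col_symbols L j = {x. \<exists>i. L i j = Some x}"

definition partial_latin_square :: "nat \<Rightarrow> 's set \<Rightarrow> 's parray \<Rightarrow> bool" where
  "partial_latin_square n S L \<longleftrightarrow>
     finite S \<and>
     filled_cells L \<subseteq> {..<n} \<times> {..<n} \<and>
     (\<forall>i j x. L i j = Some x \<longrightarrow> x \<in> S) \<and>
     (\<forall>i j j' x. L i j = Some x \<and> L i j' = Some x \<longrightarrow> j = j') \<and>
     (\<forall>i i' j x. L i j = Some x \<and> L i' j = Some x \<longrightarrow> i = i')"

text \<open>The tuple of squares is a list \<open>Ts\<close>, so its components are \<open>Ts ! 0, \<dots>, Ts ! (\<mu> - 1)\<close>.\<close>

definition latin_trade :: "nat \<Rightarrow> nat \<Rightarrow> 's set \<Rightarrow> 's parray list \<Rightarrow> bool" where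
  "latin_trade \<mu> n S Ts \<longleftrightarrow>
     0 < \<mu> \<and> length Ts = \<mu> \<and>
     (\<forall>r<\<mu>. partial_latin_square n S (Ts ! r)) \<and>
     (\<forall>r<\<mu>. \<forall>s<\<mu>. filled_cells (Ts ! r) = filled_cells (Ts ! s)) \<and>
     (\<forall>r<\<mu>. \<forall>s<\<mu>. r \<noteq> s \<longrightarrow>
        (\<forall>(i, j) \<in> filled_cells (Ts ! r). (Ts ! r) i j \<noteq> (Ts ! s) i j)) \<and>
     (\<forall>r<\<mu>. \<forall>s<\<mu>. \<forall>i<n. row_symbols (Ts ! r) i = row_symbols (Ts ! s) i) \<and>
     (\<forall>r<\<mu>. \<forall>s<\<mu>. \<forall>j<n. col_symbols (Ts ! r) j = col_symbols (Ts ! s) j)"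

definition homogeneous_latin_trade ::
    "nat \<Rightarrow> nat \<Rightarrow> nat \<Rightarrow> 's set \<Rightarrow> 's parray list \<Rightarrow> bool" where
  "homogeneous_latin_trade \<mu> k m S Ts \<longleftrightarrow>
     \<mu> \<le> k \<and> k \<le> m \<and> card S = m \<and>
     latin_trade \<mu> m S Ts \<and>
     (\<forall>r<\<mu>.
        (\<forall>i<m. card {j. (Ts ! r) i j \<noteq> None} = k) \<and>
        (\<forall>j<m. card {i. (Ts ! r) i j \<noteq> None} = k) \<and>
        (\<forall>x\<in>S. card {(i, j). (Ts ! r) i j = Some x} = k))"

end

theory Submission
  imports Defs "HOL-Number_Theory.Cong"
begin

text \<open>
  Each of the three squares is developed cyclically from a base row: with rows, columns and symbols
  in \<open>\<int>/m\<close>, cell \<open>(i, i + d)\<close> of the square number \<open>r\<close> contains \<open>i + f r d\<close>, for \<open>d\<close> in a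
  set \<open>D\<close> of \<open>m - 2\<close> residues. The sets of symbols in row \<open>i\<close> and in column \<open>j\<close> are then
  translates of \<open>{f r d | d \<in> D}\<close> and \<open>{f r d - d | d \<in> D}\<close>, so a homogeneous trade arises as
  soon as \<open>f r\<close> and \<open>f r d - d\<close> are injective on \<open>D\<close>, have images that do not depend on \<open>r\<close>,
  and \<open>f 0\<close>, \<open>f 1\<close>, \<open>f 2\<close> differ at every point of \<open>D\<close>
  (\<open>cyclic_homogeneous_latin_trade\<close>).

  For odd \<open>m\<close> the element 2 is invertible, and one can write \<open>f r x = 2 * G r x\<close>. The two
  injectivity conditions then concern \<open>z = G r x\<close> and \<open>y = 2 * z - x\<close>: that is, \<open>z\<close> is the
  midpoint of \<open>x\<close> and \<open>y\<close>. A translation \<open>z = x + s\<close>, for which \<open>y = x + 2 * s\<close>, permutes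
  \<open>\<int>/m\<close> in both respects, and translations with different \<open>s\<close> differ everywhere. But they do not
  have equal images once two values of \<open>x\<close> are removed. The remedy is local: the translations
  by \<open>1\<close>, \<open>0\<close> and \<open>-1\<close> are altered at six points each, all in the window \<open>{-4..5}\<close>, so that each
  of them misses \<open>x \<in> {0, 1}\<close>, \<open>z \<in> {-3, 4}\<close> and \<open>y \<in> {-1, 2}\<close>. Since nothing happens outside
  the window, checking these finitely many values settles every odd \<open>m \<ge> 11\<close> at once
  (\<open>midpoint_window\<close>, \<open>bij_betw_mod_extend_by_shift\<close>, \<open>odd_order_trade_exists\<close>).

  Every \<open>m > 7\<close> that is 1 modulo 6 is odd and at least 13, hence covered. The order 7 is too
  small for the window and has its own three base rows.
\<close>

section \<open>Trades developed cyclically from base rows\<close>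

definition window_rep :: "int \<Rightarrow> nat \<Rightarrow> int \<Rightarrow> int" where
  "window_rep a m x = a + (x - a) mod int m"

lemma window_rep_cong: "[window_rep a m x = x] (mod int m)"
  by (simp add: window_rep_def cong_def mod_simps)

lemma window_rep_eq_iff:
  assumes "d \<in> {a..<a + int m}"
  shows "window_rep a m x = d \<longleftrightarrow> [x = d] (mod int m)"
proof
  show "window_rep a m x = d \<Longrightarrow> [x = d] (mod int m)"
    using window_rep_cong[of a m x] by (simp add: cong_sym)
next
  assume "[x = d] (mod int m)"
  then have "[x - a = d - a] (mod int m)"
    by (rule cong_diff) simp
  then have "(x - a) mod int m = d - a"
    using assms by (simp add: cong_def)
  then show "window_rep a m x = d"
    by (simp add: window_rep_def)
qed

lemma inj_on_mod_window:
  assumes "D \<subseteq> {a..<a + int m}"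
  shows "inj_on (\<lambda>d. d mod int m) D"
proof (rule inj_onI)
  fix d e assume "d \<in> D" "e \<in> D" "d mod int m = e mod int m"
  then show "d = e"
    using assms window_rep_eq_iff[of d a m d] window_rep_eq_iff[of e a m d]
    by (metis cong_def subsetD)
qed

lemma nat_mod_eq_iff_cong:
  assumes "0 < m"
  shows "x = nat (y mod int m) \<longleftrightarrow> x < m \<and> [int x = y] (mod int m)"
proof
  assume "x = nat (y mod int m)"
  then have "int x = y mod int m"
    using assms by simp
  moreover have "y mod int m < int m"
    using assms by simp
  ultimately show "x < m \<and> [int x = y] (mod int m)"
    by (metis cong_mod_left cong_refl of_nat_less_iff)
next
  assume "x < m \<and> [int x = y] (mod int m)"
  moreover from this have "int x mod int m = int x"
    by simp
  ultimately have "int x = y mod int m"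
    by (simp add: cong_def)
  then show "x = nat (y mod int m)"
    by (metis nat_int)
qed

text \<open>
  The base row \<open>f\<close> is a function on integers rather than on residues, and \<open>D\<close> lies in an
  interval \<open>{a..<a + int m}\<close> of free position, so that a base row may be described by its values
  around 0.
\<close>

definition cyclic_array :: "nat \<Rightarrow> int \<Rightarrow> int set \<Rightarrow> (int \<Rightarrow> int) \<Rightarrow> nat parray" where
  "cyclic_array m a D f = (\<lambda>i j.
     let d = window_rep a m (int j - int i)
     in if i < m \<and> j < m \<and> d \<in> D then Some (nat ((int i + f d) mod int m)) else None)"

text \<open>
  By this description a filled cell is a triple (row, column, symbol) of the form
  \<open>(i, i + d, i + f d)\<close>; such a triple is determined by \<open>d\<close> and any one of its coordinates, and
  this symmetry is behind all counts below.
\<close>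

lemma cyclic_array_eq_Some_iff:
  assumes "D \<subseteq> {a..<a + int m}"
  shows "cyclic_array m a D f i j = Some x \<longleftrightarrow> i < m \<and> j < m \<and> x < m \<and>
           (\<exists>d\<in>D. [int j = int i + d] (mod int m) \<and> [int x = int i + f d] (mod int m))"
proof -
  have diff: "[int j - int i = d] (mod int m) \<longleftrightarrow> [int j = int i + d] (mod int m)" for d
    by (simp add: cong_iff_dvd_diff algebra_simps)
  show ?thesis
  proof (cases "i < m \<and> j < m")
    case True
    then have "0 < m" by auto
    have "(window_rep a m (int j - int i) = d \<and> x = nat ((int i + f d) mod int m)) \<longleftrightarrow>
        x < m \<and> [int j = int i + d] (mod int m) \<and> [int x = int i + f d] (mod int m)"
      if "d \<in> D" for d
      using window_rep_eq_iff[of d a m] subsetD[OF assms that] diff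
      unfolding nat_mod_eq_iff_cong[OF \<open>0 < m\<close>] by blast
    moreover have "cyclic_array m a D f i j = Some x \<longleftrightarrow>
       (\<exists>d\<in>D. window_rep a m (int j - int i) = d \<and> x = nat ((int i + f d) mod int m))"
      using True by (auto simp: cyclic_array_def Let_def)
    ultimately show ?thesis using True by auto
  qed (auto simp: cyclic_array_def Let_def)
qed

lemma cyclic_array_filled_iff:
  assumes "D \<subseteq> {a..<a + int m}"
  shows "cyclic_array m a D f i j \<noteq> None \<longleftrightarrow>
           i < m \<and> j < m \<and> (\<exists>d\<in>D. [int j = int i + d] (mod int m))"
proof -
  have "[int j - int i = d] (mod int m) \<longleftrightarrow> [int j = int i + d] (mod int m)" for d
    by (simp add: cong_iff_dvd_diff algebra_simps)
  then have "window_rep a m (int j - int i) \<in> D \<longleftrightarrow> (\<exists>d\<in>D. [int j = int i + d] (mod int m))"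
    using assms window_rep_eq_iff by (metis subsetD)
  then show ?thesis
    by (auto simp: cyclic_array_def Let_def)
qed

lemma card_translates_mod:
  assumes "0 < m" and inj: "inj_on (\<lambda>d. h d mod int m) D"
  shows "card {x. x < m \<and> (\<exists>d\<in>D. [int x = c + h d] (mod int m))} = card D"
proof -
  have "x < m \<and> (\<exists>d\<in>D. [int x = c + h d] (mod int m)) \<longleftrightarrow>
          (\<exists>d\<in>D. x = nat ((c + h d) mod int m))" for x
    unfolding nat_mod_eq_iff_cong[OF assms(1)] by blast
  then have "{x. x < m \<and> (\<exists>d\<in>D. [int x = c + h d] (mod int m))} =
          (\<lambda>d. nat ((c + h d) mod int m)) ` D"
    by auto
  moreover have "inj_on (\<lambda>d. nat ((c + h d) mod int m)) D"
  proof (rule inj_onI)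
    fix d e assume *: "d \<in> D" "e \<in> D" "nat ((c + h d) mod int m) = nat ((c + h e) mod int m)"
    then have "[c + h d = c + h e] (mod int m)"
      using assms(1) by (simp add: cong_def nat_eq_iff)
    then have "[h d = h e] (mod int m)"
      by (simp add: cong_add_lcancel)
    then show "d = e"
      using inj * by (auto simp: cong_def dest: inj_onD)
  qed
  ultimately show ?thesis
    by (simp add: card_image)
qed

text \<open>
  In terms of \<open>d\<close>, row \<open>i\<close> contains the symbols \<open>i + f r d\<close> and column \<open>j\<close> the symbols
  \<open>j + (f r d - d)\<close>. Hence the two injectivity assumptions give the Latin property, and the
  common images \<open>R\<close> and \<open>C\<close> make the row and column symbols agree. The symbol \<open>x\<close> occurs once for
  each \<open>d \<in> D\<close>, namely in row \<open>x - f r d\<close>.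
\<close>

lemma cyclic_homogeneous_latin_trade:
  fixes f :: "nat \<Rightarrow> int \<Rightarrow> int" and D R C :: "int set"
  assumes "0 < \<mu>" "\<mu> \<le> k" "k \<le> m"
    and D: "D \<subseteq> {a..<a + int m}" "card D = k"
    and row: "\<And>r. r < \<mu> \<Longrightarrow> bij_betw (\<lambda>d. f r d mod int m) D R"
    and col: "\<And>r. r < \<mu> \<Longrightarrow> bij_betw (\<lambda>d. (f r d - d) mod int m) D C"
    and disjoint: "\<And>r s d. \<lbrakk>r < \<mu>; s < \<mu>; r \<noteq> s; d \<in> D\<rbrakk> \<Longrightarrow> \<not> [f r d = f s d] (mod int m)"
  shows "homogeneous_latin_trade \<mu> k m {..<m} (map (\<lambda>r. cyclic_array m a D (f r)) [0..<\<mu>])"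
proof -
  let ?T = "\<lambda>r. cyclic_array m a D (f r)"
  have m: "0 < m" using assms(1-3) by simp
  note Some_iff = cyclic_array_eq_Some_iff[OF D(1)]
  note filled_iff = cyclic_array_filled_iff[OF D(1)]
  note inj_D = inj_on_mod_window[OF D(1)]
  have D_unique: "d = e" if "d \<in> D" "e \<in> D" "[d = e] (mod int m)" for d e
    using inj_D that by (auto simp: cong_def dest: inj_onD)
  have row_unique: "d = e" if "r < \<mu>" "d \<in> D" "e \<in> D" "[f r d = f r e] (mod int m)" for r d e
    using row[OF that(1)] that by (auto simp: cong_def bij_betw_def dest: inj_onD)
  have col_unique: "d = e"
    if "r < \<mu>" "d \<in> D" "e \<in> D" "[f r d - d = f r e - e] (mod int m)" for r d e
    using col[OF that(1)] that by (auto simp: cong_def bij_betw_def dest: inj_onD)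
  have less_unique: "x = y" if "x < m" "y < m" "[int x = z] (mod int m)" "[int y = z] (mod int m)"
    for x y z
    using that by (auto simp: cong_def)

  have pls: "partial_latin_square m {..<m} (?T r)" if r: "r < \<mu>" for r
    unfolding partial_latin_square_def
  proof (intro conjI allI impI)
    show "filled_cells (?T r) \<subseteq> {..<m} \<times> {..<m}"
      unfolding filled_cells_def filled_iff by auto
    show "?T r i j = Some x \<Longrightarrow> x \<in> {..<m}" for i j x
      by (simp add: Some_iff)
  next
    fix i j j' x
    assume *: "?T r i j = Some x \<and> ?T r i j' = Some x"
    then obtain d e where de: "d \<in> D" "e \<in> D"
      "[int j = int i + d] (mod int m)" "[int x = int i + f r d] (mod int m)"
      "[int j' = int i + e] (mod int m)" "[int x = int i + f r e] (mod int m)"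
      by (auto simp: Some_iff)
    then have "[int i + f r d = int i + f r e] (mod int m)"
      by (metis cong_sym cong_trans)
    then have "d = e"
      using row_unique r de by (simp add: cong_add_lcancel)
    then show "j = j'"
      using de * less_unique by (auto simp: Some_iff)
  next
    fix i i' j x
    assume *: "?T r i j = Some x \<and> ?T r i' j = Some x"
    then obtain d e where de: "d \<in> D" "e \<in> D"
      "[int j = int i + d] (mod int m)" "[int x = int i + f r d] (mod int m)"
      "[int j = int i' + e] (mod int m)" "[int x = int i' + f r e] (mod int m)"
      by (auto simp: Some_iff)
    have "[f r d - d = int x - int j] (mod int m)"
      using cong_diff[OF de(4) de(3)] by (simp add: cong_sym)
    moreover have "[int x - int j = f r e - e] (mod int m)"
      using cong_diff[OF de(6) de(5)] by simp
    ultimately have "d = e"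
      using col_unique r de by (metis cong_trans)
    then have "[int i = int j - d] (mod int m)" "[int i' = int j - d] (mod int m)"
      using de by (auto simp: cong_iff_dvd_diff algebra_simps dvd_diff_commute)
    then show "i = i'"
      using * less_unique by (auto simp: Some_iff)
  qed simp

  have filled: "filled_cells (?T r) = filled_cells (?T s)" for r s
    unfolding filled_cells_def filled_iff ..

  have differ: "?T r i j \<noteq> ?T s i j"
    if "r < \<mu>" "s < \<mu>" "r \<noteq> s" "(i, j) \<in> filled_cells (?T r)" for r s i j
  proof
    assume eq: "?T r i j = ?T s i j"
    from that(4) obtain x where "?T r i j = Some x"
      by (auto simp: filled_cells_def)
    moreover from this eq have "?T s i j = Some x"
      by simp
    ultimately obtain d e where de: "d \<in> D" "e \<in> D"
      "[int j = int i + d] (mod int m)" "[int x = int i + f r d] (mod int m)"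
      "[int j = int i + e] (mod int m)" "[int x = int i + f s e] (mod int m)"
      unfolding Some_iff by blast
    have "[int i + d = int i + e] (mod int m)" "[int i + f r d = int i + f s e] (mod int m)"
      using de by (metis cong_sym cong_trans)+
    then show False
      using D_unique[of d e] disjoint[OF that(1-3)] de by (auto simp: cong_add_lcancel)
  qed

  have rows: "row_symbols (?T r) i = {x. x < m \<and> (\<exists>c\<in>R. [int x = int i + c] (mod int m))}"
    if r: "r < \<mu>" and i: "i < m" for r i
  proof -
    have "row_symbols (?T r) i = {x. x < m \<and> (\<exists>d\<in>D. [int x = int i + f r d] (mod int m))}"
    proof -
      have "\<exists>j<m. [int j = int i + d] (mod int m)" for d
        using m by (intro exI[of _ "nat ((int i + d) mod int m)"]) (auto simp: cong_def nat_less_iff)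
      then show ?thesis
        using i unfolding row_symbols_def Some_iff by blast
    qed
    also have "\<dots> = {x. x < m \<and> (\<exists>c\<in>(\<lambda>d. f r d mod int m) ` D. [int x = int i + c] (mod int m))}"
      by (simp add: cong_def mod_simps)
    also have "(\<lambda>d. f r d mod int m) ` D = R"
      using row[OF r] by (simp add: bij_betw_def)
    finally show ?thesis .
  qed
  have cols: "col_symbols (?T r) j = {x. x < m \<and> (\<exists>c\<in>C. [int x = int j + c] (mod int m))}"
    if r: "r < \<mu>" and j: "j < m" for r j
  proof -
    have "col_symbols (?T r) j =
            {x. x < m \<and> (\<exists>d\<in>D. [int x = int j + (f r d - d)] (mod int m))}"
    proof -
      have ex: "\<exists>i<m. [int j = int i + d] (mod int m)" for d
        using m by (intro exI[of _ "nat ((int j - d) mod int m)"])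
          (auto simp: cong_def nat_less_iff mod_simps)
      have "[int x = int i + f r d] (mod int m) \<longleftrightarrow> [int x = int j + (f r d - d)] (mod int m)"
        if "[int j = int i + d] (mod int m)" for i d x
      proof -
        have "[int i + f r d = int j + (f r d - d)] (mod int m)"
          using cong_add[OF that cong_refl, of "f r d - d"] by (simp add: cong_sym algebra_simps)
        then show ?thesis
          by (metis cong_sym cong_trans)
      qed
      then show ?thesis
        using j ex unfolding col_symbols_def Some_iff by blast
    qed
    also have "\<dots> = {x. x < m \<and> (\<exists>c\<in>(\<lambda>d. (f r d - d) mod int m) ` D.
                                    [int x = int j + c] (mod int m))}"
      by (simp add: cong_def mod_simps)
    also have "(\<lambda>d. (f r d - d) mod int m) ` D = C"
      using col[OF r] by (simp add: bij_betw_def)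
    finally show ?thesis .
  qed

  have "card {j. ?T r i j \<noteq> None} = k" if "i < m" for r i
    using card_translates_mod[OF m inj_D] that D(2) unfolding filled_iff by simp
  moreover have "card {i. ?T r i j \<noteq> None} = k" if "j < m" for r j
  proof -
    have "inj_on (\<lambda>d. (- d) mod int m) D"
    proof (rule inj_onI)
      fix d e assume *: "d \<in> D" "e \<in> D" "(- d) mod int m = (- e) mod int m"
      then have "[d = e] (mod int m)"
        by (metis cong_def cong_minus_minus_iff)
      then show "d = e" using * D_unique by blast
    qed
    from card_translates_mod[OF m this, of "int j"]
    have "card {i. i < m \<and> (\<exists>d\<in>D. [int i = int j + - d] (mod int m))} = k"
      using D(2) by simp
    moreover have "[int i = int j + - d] (mod int m) \<longleftrightarrow> [int j = int i + d] (mod int m)" for i d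
      by (simp add: cong_iff_dvd_diff algebra_simps dvd_diff_commute)
    ultimately show ?thesis
      using that unfolding filled_iff by simp
  qed
  moreover have "card {(i, j). ?T r i j = Some x} = k" if r: "r < \<mu>" and x: "x < m" for r x
  proof -
    let ?cell = "\<lambda>d. (nat ((int x - f r d) mod int m), nat ((int x - f r d + d) mod int m))"
    have coords: "[int j = int i + d] (mod int m) \<and> [int x = int i + f r d] (mod int m) \<longleftrightarrow>
        [int i = int x - f r d] (mod int m) \<and> [int j = int x - f r d + d] (mod int m)" for i j d
    proof -
      have "[int x = int i + f r d] (mod int m) \<longleftrightarrow> [int i = int x - f r d] (mod int m)"
        by (simp add: cong_iff_dvd_diff algebra_simps dvd_diff_commute)
      moreover have "[int i + d = int x - f r d + d] (mod int m)"
        if "[int i = int x - f r d] (mod int m)"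
        using cong_add[OF that cong_refl] .
      ultimately show ?thesis
        by (metis cong_sym cong_trans)
    qed
    have "?T r i j = Some x \<longleftrightarrow> (\<exists>d\<in>D. (i, j) = ?cell d)" for i j
      using x coords unfolding Some_iff prod.inject nat_mod_eq_iff_cong[OF m] by blast
    then have "{(i, j). ?T r i j = Some x} = ?cell ` D"
      by (simp only: image_def set_eq_iff split_paired_all case_prod_conv mem_Collect_eq) simp
    moreover have "inj_on ?cell D"
    proof (rule inj_onI)
      fix d e assume *: "d \<in> D" "e \<in> D" "?cell d = ?cell e"
      then have 1: "[int x - f r d = int x - f r e] (mod int m)"
        and 2: "[int x - f r d + d = int x - f r e + e] (mod int m)"
        using m by (simp_all add: cong_def nat_eq_iff)
      have "[d = e] (mod int m)"
        using cong_diff[OF 2 1] by simp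
      then show "d = e" using * D_unique by blast
    qed
    ultimately show ?thesis
      using D(2) by (simp add: card_image)
  qed
  ultimately show ?thesis
    using assms(1-3) pls filled differ rows cols
    unfolding homogeneous_latin_trade_def latin_trade_def by auto
qed

section \<open>Three base rows for odd orders from eleven on\<close>

lemma bij_betw_mod_window: "bij_betw (\<lambda>z. z mod int m) {b..<b + int m} {0..<int m}"
proof -
  have inj: "inj_on (\<lambda>z. z mod int m) {b..<b + int m}"
    by (rule inj_on_mod_window[of _ b]) simp
  have "(\<lambda>z. z mod int m) ` {b..<b + int m} = {0..<int m}"
  proof (rule card_subset_eq)
    show "(\<lambda>z. z mod int m) ` {b..<b + int m} \<subseteq> {0..<int m}"
      by (cases "m = 0") auto
    show "card ((\<lambda>z. z mod int m) ` {b..<b + int m}) = card {0..<int m}"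
      using card_image[OF inj] by simp
  qed simp
  with inj show ?thesis
    by (simp add: bij_betw_def)
qed

text \<open>
  This is what makes a single finite table serve all orders. If \<open>g\<close> maps the window \<open>{l..u}\<close>
  without \<open>X\<close> onto the window moved by \<open>s\<close> without \<open>M\<close>, and is translation by \<open>s\<close> beyond it, then
  both pieces fit together to a map from one full period of length \<open>m\<close> onto another.
\<close>

lemma bij_betw_mod_extend_by_shift:
  assumes window: "bij_betw g ({l..u} - X) ({l + s..u + s} - M)"
    and X: "X \<subseteq> {l..u}" and M: "M \<subseteq> {l + s..u + s}"
    and shift: "\<And>x. u < x \<Longrightarrow> g x = x + s"
    and l: "l \<le> u" and u: "u < l + int m"
  shows "bij_betw (\<lambda>x. g x mod int m) ({l..<l + int m} - X)
           ({0..<int m} - (\<lambda>z. z mod int m) ` M)"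
proof -
  let ?W = "{l + s..<l + s + int m}" and ?mod = "\<lambda>z. z mod int m"
  have "bij_betw (\<lambda>x. x + s) {u<..<l + int m} {u + s<..<l + s + int m}"
    by (rule bij_betw_byWitness[where f' = "\<lambda>z. z - s"]) auto
  then have "bij_betw g {u<..<l + int m} {u + s<..<l + s + int m}"
    by (rule iffD1[OF bij_betw_cong, rotated]) (simp add: shift)
  with window have "bij_betw g (({l..u} - X) \<union> {u<..<l + int m})
                      (({l + s..u + s} - M) \<union> {u + s<..<l + s + int m})"
    by (rule bij_betw_combine) auto
  moreover have "({l..u} - X) \<union> {u<..<l + int m} = {l..<l + int m} - X"
    using X l u by auto
  moreover have "({l + s..u + s} - M) \<union> {u + s<..<l + s + int m} = ?W - M"
    using M l u by auto
  ultimately have g: "bij_betw g ({l..<l + int m} - X) (?W - M)"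
    by simp
  have "M \<subseteq> ?W"
    using M u by auto
  have "bij_betw ?mod M (?mod ` M)"
    using bij_betw_mod_window \<open>M \<subseteq> ?W\<close> refl by (rule bij_betw_subset)
  moreover have "?mod ` M \<subseteq> {0..<int m}"
    using l u by auto
  ultimately have "bij_betw ?mod (?W - M) ({0..<int m} - ?mod ` M)"
    using bij_betw_mod_window \<open>M \<subseteq> ?W\<close> by (intro bij_betw_DiffI) auto
  from bij_betw_trans[OF g this] show ?thesis
    by (simp add: comp_def)
qed

text \<open>
  The following three tables come from a computer search. The missing values cannot be the same
  pair for \<open>x\<close>, \<open>y\<close> and \<open>z\<close>: because of \<open>x\<^sup>2 + y\<^sup>2 = 2 * z\<^sup>2 + 2 * (z - x)\<^sup>2\<close>, an altered
  translation by \<open>s \<noteq> 0\<close> on a window of \<open>n\<close> elements would then have \<open>n - 2\<close> displacements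
  \<open>z - x\<close> with sum \<open>s * n\<close> and sum of squares \<open>s\<^sup>2 * n\<close>, against the Cauchy-Schwarz inequality.
  The missing \<open>z\<close> have to be spread more widely, as \<open>{-3, 4}\<close> is compared with \<open>{0, 1}\<close> and
  \<open>{-1, 2}\<close>. All three pairs are invariant under \<open>x \<mapsto> 1 - x\<close>; this reflection maps \<open>midpoint_up\<close>
  to \<open>midpoint_down\<close> and \<open>midpoint_level\<close> to itself.
\<close>

definition midpoint_up :: "int \<Rightarrow> int" where
  "midpoint_up x =
     (if x = -4 then -2 else if x = -3 then -1 else if x = -2 then 1 else if x = -1 then 2
      else if x = 2 then 0 else if x = 3 then 3 else x + 1)"

definition midpoint_level :: "int \<Rightarrow> int" where
  "midpoint_level x =
     (if x = -3 then 0 else if x = -2 then -1 else if x = -1 then -2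
      else if x = 2 then 3 else if x = 3 then 2 else if x = 4 then 1 else x)"

definition midpoint_down :: "int \<Rightarrow> int" where
  "midpoint_down x =
     (if x = -2 then -2 else if x = -1 then 1 else if x = 2 then -1 else if x = 3 then 0
      else if x = 4 then 2 else if x = 5 then 3 else x - 1)"

definition midpoint :: "nat \<Rightarrow> int \<Rightarrow> int" where
  "midpoint r = (if r = 0 then midpoint_up else if r = 1 then midpoint_level else midpoint_down)"

lemmas midpoint_defs = midpoint_def midpoint_up_def midpoint_level_def midpoint_down_def

definition offsets :: "nat \<Rightarrow> int set" where
  "offsets m = {-4..<-4 + int m} - {0, 1}"

lemma card_offsets: "6 \<le> m \<Longrightarrow> card (offsets m) = m - 2"
  by (simp add: offsets_def card_Diff_subset)

lemma midpoint_beyond: "5 < x \<Longrightarrow> r < 3 \<Longrightarrow> midpoint r x = x + (1 - int r)"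
  by (auto simp: midpoint_defs)

lemma midpoint_window:
  assumes "r < 3"
  shows "bij_betw (midpoint r) ({-4..5} - {0, 1})
           ({-4 + (1 - int r)..5 + (1 - int r)} - {-3, 4})"
    and "bij_betw (\<lambda>x. 2 * midpoint r x - x) ({-4..5} - {0, 1})
           ({-4 + (2 - 2 * int r)..5 + (2 - 2 * int r)} - {-1, 2})"
proof -
  have "\<forall>r\<in>{..<3}. bij_betw (midpoint r) ({-4..5} - {0, 1})
          ({-4 + (1 - int r)..5 + (1 - int r)} - {-3, 4})"
    "\<forall>r\<in>{..<3}. bij_betw (\<lambda>x. 2 * midpoint r x - x) ({-4..5} - {0, 1})
          ({-4 + (2 - 2 * int r)..5 + (2 - 2 * int r)} - {-1, 2})"
    by code_simp+
  with assms show "bij_betw (midpoint r) ({-4..5} - {0, 1})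
           ({-4 + (1 - int r)..5 + (1 - int r)} - {-3, 4})"
    and "bij_betw (\<lambda>x. 2 * midpoint r x - x) ({-4..5} - {0, 1})
           ({-4 + (2 - 2 * int r)..5 + (2 - 2 * int r)} - {-1, 2})"
    by auto
qed

lemma midpoint_bij_betw:
  assumes "10 \<le> m" "r < 3"
  shows "bij_betw (\<lambda>x. midpoint r x mod int m) (offsets m)
           ({0..<int m} - (\<lambda>z. z mod int m) ` {-3, 4})"
    and "bij_betw (\<lambda>x. (2 * midpoint r x - x) mod int m) (offsets m)
           ({0..<int m} - (\<lambda>y. y mod int m) ` {-1, 2})"
proof -
  show "bij_betw (\<lambda>x. midpoint r x mod int m) (offsets m)
          ({0..<int m} - (\<lambda>z. z mod int m) ` {-3, 4})"
    unfolding offsets_def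
    by (rule bij_betw_mod_extend_by_shift[OF midpoint_window(1)[OF assms(2)]])
      (use assms midpoint_beyond[OF _ assms(2)] in simp_all)
  show "bij_betw (\<lambda>x. (2 * midpoint r x - x) mod int m) (offsets m)
          ({0..<int m} - (\<lambda>y. y mod int m) ` {-1, 2})"
    unfolding offsets_def
    by (rule bij_betw_mod_extend_by_shift[OF midpoint_window(2)[OF assms(2)]])
      (use assms midpoint_beyond[OF _ assms(2)] in simp_all)
qed

text \<open>
  The bound on the distance turns inequality of integers into inequality modulo any \<open>m \<ge> 10\<close>.
\<close>

lemma midpoint_differ:
  assumes "r < 3" "s < 3" "r \<noteq> s" "x \<in> offsets m"
  shows "midpoint r x \<noteq> midpoint s x" "\<bar>midpoint r x - midpoint s x\<bar> < 10"
proof -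
  have "midpoint_up x \<noteq> midpoint_level x" "midpoint_up x \<noteq> midpoint_down x"
    "midpoint_level x \<noteq> midpoint_down x"
    using assms(4) by (auto simp: midpoint_defs offsets_def)
  then show "midpoint r x \<noteq> midpoint s x"
    using assms(1-3) by (auto simp: midpoint_def)
  have "\<bar>midpoint_up x - x\<bar> < 5" "\<bar>midpoint_level x - x\<bar> < 5" "\<bar>midpoint_down x - x\<bar> < 5"
    by (auto simp: midpoint_defs)
  then have "\<bar>midpoint r x - x\<bar> < 5" "\<bar>midpoint s x - x\<bar> < 5"
    by (auto simp: midpoint_def)
  then show "\<bar>midpoint r x - midpoint s x\<bar> < 10"
    by linarith
qed

lemma odd_order_trade_exists:
  assumes "odd m" "11 \<le> m"
  shows "\<exists>Ts. homogeneous_latin_trade 3 (m - 2) m {..<m} Ts"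
proof -
  have coprime: "coprime 2 (int m)"
    using assms(1) by simp
  define Z where "Z = {0..<int m} - (\<lambda>z. z mod int m) ` {-3, 4}"
  have inj_double: "inj_on (\<lambda>z. (2 * z) mod int m) Z"
  proof (rule inj_onI)
    fix z z' assume *: "z \<in> Z" "z' \<in> Z" "(2 * z) mod int m = (2 * z') mod int m"
    then have "[z = z'] (mod int m)"
      using cong_mult_lcancel[OF coprime] by (simp add: cong_def)
    then show "z = z'"
      using * by (simp add: Z_def cong_def)
  qed
  have "homogeneous_latin_trade 3 (m - 2) m {..<m}
          (map (\<lambda>r. cyclic_array m (-4) (offsets m) (\<lambda>x. 2 * midpoint r x)) [0..<3])"
  proof (rule cyclic_homogeneous_latin_trade)
    show "offsets m \<subseteq> {-4..<-4 + int m}"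
      by (auto simp: offsets_def)
    show "card (offsets m) = m - 2"
      using assms by (simp add: card_offsets)
  next
    fix r :: nat assume r: "r < 3"
    have "bij_betw ((\<lambda>z. (2 * z) mod int m) \<circ> (\<lambda>x. midpoint r x mod int m)) (offsets m)
            ((\<lambda>z. (2 * z) mod int m) ` Z)"
      using midpoint_bij_betw(1)[of m r] assms r inj_double
      by (intro bij_betw_trans[of _ _ Z]) (auto simp: Z_def bij_betw_def)
    then show "bij_betw (\<lambda>x. 2 * midpoint r x mod int m) (offsets m)
                 ((\<lambda>z. (2 * z) mod int m) ` Z)"
      by (simp add: comp_def mod_simps)
    show "bij_betw (\<lambda>x. (2 * midpoint r x - x) mod int m) (offsets m)
            ({0..<int m} - (\<lambda>y. y mod int m) ` {-1, 2})"
      using midpoint_bij_betw(2) assms r by simp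
  next
    fix r s :: nat and x
    assume rs: "r < 3" "s < 3" "r \<noteq> s" "x \<in> offsets m"
    show "\<not> [2 * midpoint r x = 2 * midpoint s x] (mod int m)"
    proof
      assume "[2 * midpoint r x = 2 * midpoint s x] (mod int m)"
      then have "int m dvd midpoint r x - midpoint s x"
        using cong_mult_lcancel[OF coprime] by (simp add: cong_iff_dvd_diff)
      then show False
        using midpoint_differ[OF rs] assms(2)
          dvd_imp_le_int[of "midpoint r x - midpoint s x" "int m"] by linarith
    qed
  qed (use assms in simp_all)
  then show ?thesis by blast
qed

section \<open>Order seven\<close>

text \<open>
  The base rows, defined on the offsets 2 to 6, were found by exhaustive search: each is a
  permutation of \<open>{2, 3, 4, 5, 6}\<close>, and its differences to the offsets miss 1 and 6 modulo 7.
\<close>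

definition base_row_7 :: "nat \<Rightarrow> int \<Rightarrow> int" where
  "base_row_7 r d = [[4, 6, 2, 5, 3], [5, 3, 6, 2, 4], [6, 5, 4, 3, 2]] ! r ! nat (d - 2)"

lemma order_7_trade_exists: "\<exists>Ts. homogeneous_latin_trade 3 5 7 {..<7::nat} Ts"
proof -
  have "homogeneous_latin_trade 3 5 7 {..<7}
          (map (\<lambda>r. cyclic_array 7 0 {2, 3, 4, 5, 6} (base_row_7 r)) [0..<3])"
  proof (rule cyclic_homogeneous_latin_trade)
    fix r :: nat assume "r < 3"
    then consider "r = 0" | "r = 1" | "r = 2" by linarith
    then show "bij_betw (\<lambda>d. base_row_7 r d mod int 7) {2, 3, 4, 5, 6} {2, 3, 4, 5, 6}"
      and "bij_betw (\<lambda>d. (base_row_7 r d - d) mod int 7) {2, 3, 4, 5, 6} {0, 2, 3, 4, 5}"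
      by (cases; simp add: bij_betw_def inj_on_def base_row_7_def insert_commute)+
  next
    fix r s :: nat and d :: int
    assume "r < 3" "s < 3" "r \<noteq> s" "d \<in> {2, 3, 4, 5, 6}"
    then show "\<not> [base_row_7 r d = base_row_7 s d] (mod int 7)"
      by (auto simp: less_Suc_eq numeral_3_eq_3 base_row_7_def cong_def)
  qed simp_all
  then show ?thesis by blast
qed

theorem theorem12:
  fixes m :: nat
  assumes "m mod 6 = 1" and "m \<ge> 7"
  shows "\<exists>(S :: nat set) Ts. homogeneous_latin_trade 3 (m - 2) m S Ts"
proof (cases "m = 7")
  case True
  then show ?thesis
    using order_7_trade_exists by auto
next
  case False
  with assms have "odd m" "11 \<le> m"
    by presburger+
  then show ?thesis
    using odd_order_trade_exists by blast
qed

end
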